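(* Let $p$ and $q$ be distinct primes. Then for any integer $r$ with $1\le r\le pq-1$, there exists an ordered triple $(a,b,c)$ of nonnegative integers such that $$\binom{pq}{r}=a\binom{pq}{1}+b\binom{pq}{p}+c\binom{pq}{q}.$$ In particular, for such a triple one has the congruence $$\binom{pq}{r}\equiv bq+cp\pmod{pq}.$$ *)

theory Defs
  imports "HOL-Number_Theory.Number_Theory"
begin

end

theory Submission
  imports Defs
begin

text \<open>
  Put \<open>n = p * q\<close>. If neither prime divides \<open>r\<close>, then \<open>n\<close> divides \<open>n choose r\<close>, and
  \<open>n choose 1\<close> suffices. If \<open>r = k * p\<close>, write \<open>n choose r = q * m\<close> and
  \<open>n choose p = q * u\<close>, where \<open>u\<close> is congruent to 1 modulo \<open>p\<close>; taking \<open>b = m mod p\<close> makes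
  \<open>(n choose r) - b * (n choose p)\<close> a multiple of \<open>n\<close>, and it is nonnegative since
  \<open>n choose r\<close> is at least \<open>2 ^ p * (n choose p)\<close> unless \<open>k = 1\<close> or \<open>k = q - 1\<close>.
\<close>

lemma Suc_times_binomial_Suc: "Suc k * (n choose Suc k) = (n - k) * (n choose k)"
  using binomial_absorption[of k n] binomial_absorb_comp[of n k] by simp

text \<open>Passing from \<open>k\<close> to \<open>Suc k\<close> multiplies the binomials by
  \<open>(m - k) / Suc k\<close> and \<open>(2 * m - k) / Suc k\<close>; the second factor is at
  least twice the first.\<close>

lemma power2_times_binomial_le: "2 ^ k * (m choose k) \<le> (2 * m choose k)"
proof (induction k)
  case (Suc k)
  have "Suc k * (2 ^ Suc k * (m choose Suc k)) = (2 * (m - k)) * (2 ^ k * (m choose k))"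
    using arg_cong[OF Suc_times_binomial_Suc[of k m], of "\<lambda>x. 2 ^ Suc k * x"]
    by (simp only: power_Suc ac_simps)
  also have "\<dots> \<le> (2 * m - k) * (2 * m choose k)"
    by (intro mult_mono Suc.IH) auto
  also have "\<dots> = Suc k * (2 * m choose Suc k)"
    by (simp only: Suc_times_binomial_Suc)
  finally show ?case
    by (simp only: Suc_mult_le_cancel1)
qed simp

text \<open>Ordered pairs of disjoint \<open>p\<close>-subsets of an \<open>n\<close>-set number
  both \<open>(n choose p) * ((n - p) choose p)\<close> and
  \<open>(n choose (2 * p)) * ((2 * p) choose p)\<close>. Since \<open>n - p\<close> is at least
  \<open>4 * p\<close>, the preceding doubling bound applies to the factor
  \<open>(n - p) choose p\<close>.\<close>

lemma power2_times_binomial_le_double: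
  assumes "5 * p \<le> n"
  shows "2 ^ p * (n choose p) \<le> (n choose (2 * p))"
proof -
  have "(n choose p) * (2 ^ p * ((2 * p) choose p)) \<le> (n choose p) * ((2 * (2 * p)) choose p)"
    by (intro mult_left_mono power2_times_binomial_le) auto
  also have "\<dots> \<le> (n choose p) * ((n - p) choose p)"
    using assms by (intro mult_left_mono binomial_right_mono) auto
  also have "\<dots> = (n choose (2 * p)) * ((2 * p) choose p)"
    using choose_mult[of p "2 * p" n] assms by simp
  finally have "(2 ^ p * (n choose p)) * ((2 * p) choose p)
      \<le> (n choose (2 * p)) * ((2 * p) choose p)"
    by (simp only: ac_simps)
  then show ?thesis
    by simp
qed

lemma prime_dvd_binomial_of_multiple:
  fixes p n j :: nat
  assumes "prime p" "p dvd n" "\<not> p dvd j"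
  shows "p dvd (n choose j)"
proof -
  from assms(3) obtain i where "j = Suc i"
    by (cases j) auto
  then have "j * (n choose j) = n * ((n - 1) choose i)"
    using binomial_absorption[of i n] by simp
  then have "p dvd j * (n choose j)"
    using assms(2) by simp
  then show ?thesis
    using assms(1,3) prime_dvd_mult_iff by blast
qed

text \<open>By Pascal's rule, neighbours in row \<open>n - 1\<close> add up to an entry of row
  \<open>n\<close> that \<open>p\<close> divides, so they are negatives of each other modulo
  \<open>p\<close>.\<close>

lemma binomial_multiple_minus_one_cong:
  assumes "prime p" "p dvd n" "0 < n" "j < p"
  shows "[int ((n - 1) choose j) = (- 1) ^ j] (mod int p)"
  using \<open>j < p\<close>
proof (induction j)
  case (Suc j)
  have "(n choose Suc j) = ((n - 1) choose j) + ((n - 1) choose Suc j)"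
    using \<open>0 < n\<close> by (cases n) auto
  moreover have "p dvd (n choose Suc j)"
    using assms Suc.prems by (intro prime_dvd_binomial_of_multiple) (auto dest: nat_dvd_not_less)
  ultimately have "int p dvd int ((n - 1) choose j) + int ((n - 1) choose Suc j)"
    by (metis int_dvd_int_iff of_nat_add)
  moreover have "int p dvd int ((n - 1) choose j) - (- 1) ^ j"
    using Suc by (simp add: cong_iff_dvd_diff)
  ultimately have "int p dvd (int ((n - 1) choose j) + int ((n - 1) choose Suc j))
      - (int ((n - 1) choose j) - (- 1) ^ j)"
    by (rule dvd_diff)
  then show ?case
    by (simp add: cong_iff_dvd_diff algebra_simps)
qed simp

lemma binomial_prime_mult:
  assumes "prime p" "0 < q"
  obtains u where "(p * q) choose p = q * u" "[u = 1] (mod p)"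
proof
  have "p > 0"
    using assms(1) by (simp add: prime_gt_0_nat)
  then have "p * ((p * q) choose p) = p * (q * ((p * q - 1) choose (p - 1)))"
    using binomial_absorption[of "p - 1" "p * q"] by (simp add: mult.assoc)
  then show "(p * q) choose p = q * ((p * q - 1) choose (p - 1))"
    using \<open>p > 0\<close> by simp
  have "[int ((p * q - 1) choose (p - 1)) = (- 1) ^ (p - 1)] (mod int p)"
    using assms \<open>p > 0\<close> by (intro binomial_multiple_minus_one_cong) auto
  \<comment> \<open>For odd \<open>p\<close> the exponent is even; for \<open>p = 2\<close> the
    signs agree modulo 2.\<close>
  also have "[(- 1) ^ (p - 1) = (1 :: int)] (mod int p)"
  proof (cases "p = 2")
    case False
    then have "even (p - 1)"
      using assms(1) prime_odd_nat[of p] prime_ge_2_nat[of p] by fastforce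
    then show ?thesis
      by simp
  qed (simp add: cong_def)
  finally show "[(p * q - 1) choose (p - 1) = 1] (mod p)"
    by (metis cong_int_iff of_nat_1)
qed

lemma binomial_prime_mult_cong:
  assumes "prime p" "0 < q"
  shows "[(p * q) choose p = q] (mod (p * q))"
proof -
  obtain u where u: "(p * q) choose p = q * u" "[u = 1] (mod p)"
    using assms by (rule binomial_prime_mult)
  then have "q * u mod (q * p) = q * 1 mod (q * p)"
    unfolding cong_def by (simp only: mult_mod_right [symmetric])
  then show ?thesis
    using u(1) by (simp add: cong_def mult.commute)
qed

lemma binomial_symmetric_multiple:
  fixes p q k :: nat
  assumes "k \<le> q"
  shows "(p * q) choose ((q - k) * p) = (p * q) choose (k * p)"
proof -
  have "k * p \<le> p * q"
    using assms by (simp add: mult.commute)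
  moreover have "(q - k) * p = p * q - k * p"
    by (simp add: diff_mult_distrib mult.commute[of p])
  ultimately show ?thesis
    using binomial_symmetric by metis
qed

text \<open>The row increases up to its middle, so \<open>k = 2\<close> is the worst case; the bound
  \<open>5 \<le> q\<close> is what the comparison of \<open>2 * p\<close> with \<open>p\<close>
  requires.\<close>

lemma power2_times_binomial_le_multiple:
  assumes "5 \<le> q" "2 \<le> k" "k \<le> q - 2"
  shows "2 ^ p * ((p * q) choose p) \<le> ((p * q) choose (k * p))"
proof -
  have half: "((p * q) choose (2 * p)) \<le> ((p * q) choose (l * p))"
    if "2 \<le> l" "2 * l \<le> q" for l
    using that by (intro binomial_mono) auto
  have "((p * q) choose (2 * p)) \<le> ((p * q) choose (k * p))"
  proof (cases "2 * k \<le> q")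
    case True
    then show ?thesis
      using half assms by blast
  next
    \<comment> \<open>Reflecting \<open>k\<close> to \<open>q - k\<close> lands in the lower half,
      and \<open>k \<le> q - 2\<close> keeps the reflected index at least 2.\<close>
    case False
    then show ?thesis
      using half[of "q - k"] binomial_symmetric_multiple[of k q p] assms by simp
  qed
  moreover have "5 * p \<le> p * q"
    using assms(1) by simp
  ultimately show ?thesis
    using power2_times_binomial_le_double le_trans by blast
qed

text \<open>The primes play different roles here, so that exchanging them also settles the multiples
  of \<open>q\<close>.\<close>

lemma binomial_multiple_decomposition:
  assumes "prime p" "prime q" "0 < k" "k < q"
  shows "\<exists>a b. (p * q) choose (k * p) = a * (p * q) + b * ((p * q) choose p)"
proof (cases "k = 1 \<or> k = q - 1")
  case True
  have "(p * q) choose ((q - 1) * p) = (p * q) choose p"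
    using binomial_symmetric_multiple[of 1 q p] assms by simp
  with True have "(p * q) choose (k * p) = 0 * (p * q) + 1 * ((p * q) choose p)"
    by auto
  then show ?thesis
    by blast
next
  case False
  \<comment> \<open>Excluding the end values of \<open>k\<close> only forces
    \<open>4 \<le> q\<close>; primality supplies the missing step to 5.\<close>
  have "q \<noteq> 4"
    using assms(2) by (auto dest: prime_odd_nat)
  with False assms have k: "5 \<le> q" "2 \<le> k" "k \<le> q - 2"
    by linarith+
  have pos: "0 < p" "0 < q"
    using assms by (auto simp: prime_gt_0_nat)
  obtain u where u: "(p * q) choose p = q * u" "[u = 1] (mod p)"
    using assms(1) pos(2) by (rule binomial_prime_mult)
  \<comment> \<open>Absorption, with \<open>p\<close> cancelled, shows that \<open>q\<close> divides
    \<open>k\<close> times the binomial; \<open>q\<close> is prime and does not divide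
    \<open>k\<close>.\<close>
  have "(k * p) * ((p * q) choose (k * p)) = (p * q) * ((p * q - 1) choose (k * p - 1))"
    using binomial_absorption[of "k * p - 1" "p * q"] pos assms(3) by simp
  then have "p * (k * ((p * q) choose (k * p))) = p * (q * ((p * q - 1) choose (k * p - 1)))"
    by (simp only: ac_simps)
  then have "k * ((p * q) choose (k * p)) = q * ((p * q - 1) choose (k * p - 1))"
    using pos by simp
  then have "q dvd k * ((p * q) choose (k * p))"
    by simp
  moreover have "\<not> q dvd k"
    using assms by (auto dest: nat_dvd_not_less)
  ultimately have "q dvd ((p * q) choose (k * p))"
    using assms(2) prime_dvd_mult_iff by blast
  then obtain m where m: "(p * q) choose (k * p) = q * m"
    by (elim dvdE)
  define b where "b = m mod p"
  have "b < p"
    using pos by (simp add: b_def)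
  have "b \<le> 2 ^ p"
    using \<open>b < p\<close> less_exp[of p] by linarith
  have "q * (2 ^ p * u) \<le> q * m"
    using power2_times_binomial_le_multiple[OF k, of p] u(1) m by (simp add: ac_simps)
  then have "2 ^ p * u \<le> m"
    using pos by simp
  \<comment> \<open>This keeps the natural-number difference \<open>m - b * u\<close> from being
    truncated, so its quotient by \<open>p\<close> is a genuine coefficient
    \<open>a\<close>.\<close>
  then have le: "b * u \<le> m"
    using mult_le_mono1[OF \<open>b \<le> 2 ^ p\<close>, of u] by linarith
  have "[b * u = m * 1] (mod p)"
    using u(2) by (intro cong_mult) (auto simp: b_def)
  then have "p dvd m - b * u"
    using le cong_altdef_nat[of "b * u" m p] by (simp add: cong_sym_eq)
  then obtain a where "m - b * u = p * a"
    by (elim dvdE)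
  then have "m = p * a + b * u"
    using le by linarith
  then have "(p * q) choose (k * p) = a * (p * q) + b * ((p * q) choose p)"
    using m u(1) by (simp add: algebra_simps)
  then show ?thesis
    by blast
qed

theorem corollary4p1:
  fixes p q r :: nat
  assumes "prime p" and "prime q" and "p \<noteq> q"
    and "1 \<le> r" and "r \<le> p * q - 1"
  shows "(\<exists>a b c :: nat.
            (p * q) choose r =
              a * ((p * q) choose 1) + b * ((p * q) choose p) + c * ((p * q) choose q)) \<and>
         (\<forall>a b c :: nat.
            (p * q) choose r =
              a * ((p * q) choose 1) + b * ((p * q) choose p) + c * ((p * q) choose q) \<longrightarrow>
            [(p * q) choose r = b * q + c * p] (mod (p * q)))"
proof (intro conjI allI impI)
  have pos: "0 < p" "0 < q"
    using assms by (auto simp: prime_gt_0_nat)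
  then have "r < p * q"
    using assms(4,5) by linarith
  consider "p dvd r" | "q dvd r" | "\<not> p dvd r" "\<not> q dvd r"
    by blast
  then show "\<exists>a b c :: nat. (p * q) choose r =
      a * ((p * q) choose 1) + b * ((p * q) choose p) + c * ((p * q) choose q)"
  proof cases
    case 1
    then obtain k where k: "r = k * p"
      by (metis dvdE mult.commute)
    with \<open>r < p * q\<close> assms(4) have "0 < k" "k < q"
      by (auto simp: mult.commute intro: Nat.gr0I)
    from binomial_multiple_decomposition[OF assms(1,2) this] obtain a b where
      "(p * q) choose r = a * (p * q) + b * ((p * q) choose p)"
      using k by blast
    then have "(p * q) choose r =
      a * ((p * q) choose 1) + b * ((p * q) choose p) + 0 * ((p * q) choose q)"
      by simp
    then show ?thesis
      by blast
  next
    case 2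
    then obtain k where k: "r = k * q"
      by (metis dvdE mult.commute)
    with \<open>r < p * q\<close> assms(4) have "0 < k" "k < p"
      by (auto intro: Nat.gr0I)
    from binomial_multiple_decomposition[OF assms(2,1) this] obtain a c where
      "(q * p) choose r = a * (q * p) + c * ((q * p) choose q)"
      using k by blast
    then have "(p * q) choose r =
      a * ((p * q) choose 1) + 0 * ((p * q) choose p) + c * ((p * q) choose q)"
      by (simp add: mult.commute)
    then show ?thesis
      by blast
  next
    case 3
    have "p dvd ((p * q) choose r)" "q dvd ((p * q) choose r)"
      using 3 assms by (auto intro: prime_dvd_binomial_of_multiple)
    moreover have "coprime p q"
      using assms by (simp add: primes_coprime)
    ultimately have "p * q dvd ((p * q) choose r)"
      by (rule divides_mult)
    then obtain a where "(p * q) choose r = (p * q) * a"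
      by (elim dvdE)
    then have "(p * q) choose r =
      a * ((p * q) choose 1) + 0 * ((p * q) choose p) + 0 * ((p * q) choose q)"
      by simp
    then show ?thesis
      by blast
  qed
next
  fix a b c :: nat
  assume eq: "(p * q) choose r =
      a * ((p * q) choose 1) + b * ((p * q) choose p) + c * ((p * q) choose q)"
  have pos: "0 < p" "0 < q"
    using assms by (auto simp: prime_gt_0_nat)
  have "[a * ((p * q) choose 1) = 0] (mod (p * q))"
    by (simp add: cong_0_iff)
  \<comment> \<open>Every coefficient triple is covered at once, because the three basis binomials
    reduce to 0, \<open>q\<close> and \<open>p\<close> modulo \<open>p * q\<close>.\<close>
  moreover have "[(p * q) choose p = q] (mod (p * q))"
    using assms(1) pos(2) by (rule binomial_prime_mult_cong)
  moreover have "[(p * q) choose q = p] (mod (p * q))"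
    using binomial_prime_mult_cong[OF assms(2) pos(1)] by (simp add: mult.commute)
  ultimately have "[a * ((p * q) choose 1) + b * ((p * q) choose p) + c * ((p * q) choose q)
      = 0 + b * q + c * p] (mod (p * q))"
    by (intro cong_add cong_mult cong_refl)
  then show "[(p * q) choose r = b * q + c * p] (mod (p * q))"
    by (simp add: eq)
qed

end
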